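(* Let $Q(1)=\{(t,x)\in\mathbb{R}\times\mathbb{R}^{n+1}: x_1^2+\dots+x_{n+1}^2=1\}\subset\mathbb{L}^{n+2}$. A spacelike immersion $\Psi=(\Psi_0,\Psi_1,\dots,\Psi_{n+1})\colon M^k\to Q(1)\subset\mathbb{L}^{n+2}$ is stationary in $Q(1)$ if and only if $$\Delta\Psi_0=0\quad\text{and}\quad \Delta\Psi_i+\big(k+\|\nabla\Psi_0\|^2\big)\Psi_i=0,\qquad i=1,2,\dots,n+1.$$
   Context: $\mathbb{L}^{n+2}$ is $\mathbb{R}^{n+2}$ with coordinates $(t,x)=(t,x_1,\dots,x_{n+1})$ and the Lorentzian metric $-dt^2+dx_1^2+\dots+dx_{n+1}^2$. $Q(1)$, with the induced Lorentzian metric, is the static Einstein spacetime $\mathbb{R}\times\mathbb{S}^n$ with metric $-dt^2+g_{\mathbb{S}^n}$. A spacelike immersion is an immersion of a $k$-dimensional manifold $M^k$ whose induced metric is Riemannian; $M^k$ is endowed with the induced metric. $\nabla$, $\Delta=\mathrm{div}\,\nabla$ and $\|\cdot\|$ are the gradient, Laplacian and norm of that metric. A spacelike immersion is stationary in $Q(1)$ if its mean curvature vector field (the normalized trace of its second fundamental form in $Q(1)$) vanishes identically. *)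

theory Defs
  imports "HOL-Analysis.Analysis"
begin

section \<open>Smooth functions on open subsets of Euclidean space\<close>

primrec Ck_on :: "nat \<Rightarrow> 'a::real_normed_vector set \<Rightarrow> ('a \<Rightarrow> 'b::real_normed_vector) \<Rightarrow> bool" where
  "Ck_on 0 S f \<longleftrightarrow> continuous_on S f"
| "Ck_on (Suc r) S f \<longleftrightarrow>
     (\<forall>x\<in>S. f differentiable (at x)) \<and> (\<forall>v. Ck_on r S (\<lambda>x. frechet_derivative f (at x) v))"

definition smooth_on :: "'a::real_normed_vector set \<Rightarrow> ('a \<Rightarrow> 'b::real_normed_vector) \<Rightarrow> bool" where
  "smooth_on S f \<longleftrightarrow> (\<forall>r. Ck_on r S f)"

definition partial_deriv :: "'k::finite \<Rightarrow> (real^'k \<Rightarrow> 'b::real_normed_vector) \<Rightarrow> real^'k \<Rightarrow> 'b" where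
  "partial_deriv i f x = frechet_derivative f (at x) (axis i 1)"


section \<open>Smooth manifolds\<close>

text \<open>A chart is a pair of its domain and its coordinate map. The values of the coordinate map
  outside of the domain are irrelevant. The dimension of the manifold is \<open>CARD('k)\<close>.\<close>

type_synonym ('m, 'k) chart = "'m set \<times> ('m \<Rightarrow> real^'k)"

definition is_chart :: "'m topology \<Rightarrow> ('m, 'k::finite) chart \<Rightarrow> bool" where
  "is_chart M c \<longleftrightarrow>
     openin M (fst c) \<and> open (snd c ` fst c) \<and>
     homeomorphic_map (subtopology M (fst c)) (top_of_set (snd c ` fst c)) (snd c)"

definition coord_rep :: "('m, 'k::finite) chart \<Rightarrow> ('m \<Rightarrow> 'b) \<Rightarrow> real^'k \<Rightarrow> 'b" where
  "coord_rep c f = f \<circ> inv_into (fst c) (snd c)"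

definition smooth_manifold :: "'m topology \<Rightarrow> ('m, 'k::finite) chart set \<Rightarrow> bool" where
  "smooth_manifold M A \<longleftrightarrow>
     Hausdorff_space M \<and> second_countable M \<and>
     (\<forall>c\<in>A. is_chart M c) \<and> (\<Union>c\<in>A. fst c) = topspace M \<and>
     (\<forall>c\<in>A. \<forall>d\<in>A. smooth_on (snd c ` (fst c \<inter> fst d)) (coord_rep c (snd d)))"

definition smooth_map ::
  "('m, 'k::finite) chart set \<Rightarrow> ('m \<Rightarrow> 'b::real_normed_vector) \<Rightarrow> bool" where
  "smooth_map A f \<longleftrightarrow> (\<forall>c\<in>A. smooth_on (snd c ` fst c) (coord_rep c f))"

text \<open>Tensor fields are given by their components in every chart. A number or a vector of the
  ambient space which does not depend on the coordinates in which it is computed is evaluated at a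
  point in some chart of the atlas around that point.\<close>

definition chart_at :: "('m, 'k::finite) chart set \<Rightarrow> 'm \<Rightarrow> ('m, 'k) chart" where
  "chart_at A p = (SOME c. c \<in> A \<and> p \<in> fst c)"

type_synonym ('m, 'k) vector_field = "('m, 'k) chart \<Rightarrow> real^'k \<Rightarrow> real^'k"
type_synonym ('m, 'k) metric_field = "('m, 'k) chart \<Rightarrow> real^'k \<Rightarrow> real^'k^'k"


section \<open>Gradient, divergence and Laplacian of a Riemannian metric\<close>

text \<open>\<open>christoffel g l i j\<close> is the symbol with upper index \<open>l\<close> and lower indices \<open>i\<close>, \<open>j\<close>
  of the Levi-Civita connection of \<open>g\<close>.\<close>

definition christoffel ::
  "(real^'k::finite \<Rightarrow> real^'k^'k) \<Rightarrow> 'k \<Rightarrow> 'k \<Rightarrow> 'k \<Rightarrow> real^'k \<Rightarrow> real" where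
  "christoffel g l i j x = (1/2) * (\<Sum>m\<in>UNIV. matrix_inv (g x) $ l $ m *
     (partial_deriv i (\<lambda>y. g y $ j $ m) x + partial_deriv j (\<lambda>y. g y $ i $ m) x
      - partial_deriv m (\<lambda>y. g y $ i $ j) x))"

definition gradient :: "('m, 'k::finite) metric_field \<Rightarrow> ('m \<Rightarrow> real) \<Rightarrow> ('m, 'k) vector_field" where
  "gradient g f c x = matrix_inv (g c x) *v (\<chi> j. partial_deriv j (coord_rep c f) x)"

text \<open>The divergence of \<open>X\<close> is the trace of its covariant derivative.\<close>

definition divergence ::
  "('m, 'k::finite) chart set \<Rightarrow> ('m, 'k) metric_field \<Rightarrow> ('m, 'k) vector_field \<Rightarrow> 'm \<Rightarrow> real" where
  "divergence A g X p = (let c = chart_at A p; x = snd c p in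
     \<Sum>i\<in>UNIV. partial_deriv i (\<lambda>y. X c y $ i) x + (\<Sum>l\<in>UNIV. christoffel (g c) i i l x * X c x $ l))"

definition laplacian ::
  "('m, 'k::finite) chart set \<Rightarrow> ('m, 'k) metric_field \<Rightarrow> ('m \<Rightarrow> real) \<Rightarrow> 'm \<Rightarrow> real" where
  "laplacian A g f = divergence A g (gradient g f)"

definition metric_norm ::
  "('m, 'k::finite) chart set \<Rightarrow> ('m, 'k) metric_field \<Rightarrow> ('m, 'k) vector_field \<Rightarrow> 'm \<Rightarrow> real" where
  "metric_norm A g X p = (let c = chart_at A p; x = snd c p in sqrt (X c x \<bullet> (g c x *v X c x)))"


section \<open>Lorentz-Minkowski space and the static Einstein spacetime\<close>

text \<open>The point with coordinates \<open>(t, x)\<close> of the Lorentz-Minkowski space of dimension \<open>n + 2\<close> is a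
  pair of a real number and a vector indexed by a type \<open>'d\<close> with \<open>n + 1\<close> elements.\<close>

type_synonym 'd minkowski = "real \<times> (real^'d)"

definition lorentz :: "'d::finite minkowski \<Rightarrow> 'd minkowski \<Rightarrow> real" where
  "lorentz u v = - (fst u * fst v) + snd u \<bullet> snd v"

definition Q1 :: "'d::finite minkowski set" where
  "Q1 = {(t, x). (\<Sum>i\<in>UNIV. (x $ i)^2) = 1}"

text \<open>The kernel of the differential of \<open>(t, x) \<mapsto> \<Sum>i. (x $ i)^2\<close> at \<open>q\<close>.\<close>

definition tangent_Q1 :: "'d::finite minkowski \<Rightarrow> 'd minkowski set" where
  "tangent_Q1 q = {v. (\<Sum>i\<in>UNIV. snd q $ i * snd v $ i) = 0}"

text \<open>Orthogonal projection onto a subspace to which the Lorentzian product restricts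
  nondegenerately.\<close>

definition lorentz_proj :: "'d::finite minkowski set \<Rightarrow> 'd minkowski \<Rightarrow> 'd minkowski" where
  "lorentz_proj S v = (THE u. u \<in> S \<and> (\<forall>w\<in>S. lorentz (v - u) w = 0))"


section \<open>Spacelike immersions\<close>

definition differential ::
  "('m \<Rightarrow> 'd::finite minkowski) \<Rightarrow> ('m, 'k::finite) chart \<Rightarrow> real^'k \<Rightarrow> real^'k \<Rightarrow> 'd minkowski" where
  "differential \<Psi> c x = frechet_derivative (coord_rep c \<Psi>) (at x)"

definition induced_metric :: "('m \<Rightarrow> 'd::finite minkowski) \<Rightarrow> ('m, 'k::finite) metric_field" where
  "induced_metric \<Psi> c x =
     (\<chi> i j. lorentz (differential \<Psi> c x (axis i 1)) (differential \<Psi> c x (axis j 1)))"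

definition spacelike_immersion ::
  "'m topology \<Rightarrow> ('m, 'k::finite) chart set \<Rightarrow> ('m \<Rightarrow> 'd::finite minkowski) \<Rightarrow> bool" where
  "spacelike_immersion M A \<Psi> \<longleftrightarrow>
     smooth_map A \<Psi> \<and>
     (\<forall>c\<in>A. \<forall>x\<in>snd c ` fst c.
        inj (differential \<Psi> c x) \<and> (\<forall>v. v \<noteq> 0 \<longrightarrow> v \<bullet> (induced_metric \<Psi> c x *v v) > 0))"

text \<open>For coordinate fields \<open>X\<close>, \<open>Y\<close> with indices \<open>i\<close>, \<open>j\<close> the second partial derivative of the
  immersion is the derivative of \<open>d\<Psi> Y\<close> in the direction of \<open>d\<Psi> X\<close> for the flat connection of the
  ambient space. Its projection to the tangent space of \<open>Q1\<close> is the derivative for the Levi-Civita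
  connection of the induced metric of \<open>Q1\<close>, and the second fundamental form in \<open>Q1\<close> is the part
  of the latter normal to the immersion.\<close>

definition connection_Q1 ::
  "('m \<Rightarrow> 'd::finite minkowski) \<Rightarrow> ('m, 'k::finite) chart \<Rightarrow> real^'k \<Rightarrow> 'k \<Rightarrow> 'k \<Rightarrow> 'd minkowski" where
  "connection_Q1 \<Psi> c x i j =
     lorentz_proj (tangent_Q1 (coord_rep c \<Psi> x)) (partial_deriv i (\<lambda>y. differential \<Psi> c y (axis j 1)) x)"

definition second_fundamental_form ::
  "('m \<Rightarrow> 'd::finite minkowski) \<Rightarrow> ('m, 'k::finite) chart \<Rightarrow> real^'k \<Rightarrow> 'k \<Rightarrow> 'k \<Rightarrow> 'd minkowski" where
  "second_fundamental_form \<Psi> c x i j =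
     connection_Q1 \<Psi> c x i j - lorentz_proj (range (differential \<Psi> c x)) (connection_Q1 \<Psi> c x i j)"

definition mean_curvature ::
  "('m, 'k::finite) chart set \<Rightarrow> ('m \<Rightarrow> 'd::finite minkowski) \<Rightarrow> 'm \<Rightarrow> 'd minkowski" where
  "mean_curvature A \<Psi> p = (let c = chart_at A p; x = snd c p in
     (1 / real CARD('k)) *\<^sub>R
       (\<Sum>i\<in>UNIV. \<Sum>j\<in>UNIV.
          (matrix_inv (induced_metric \<Psi> c x) $ i $ j) *\<^sub>R second_fundamental_form \<Psi> c x i j))"

definition stationary_in_Q1 ::
  "'m topology \<Rightarrow> ('m, 'k::finite) chart set \<Rightarrow> ('m \<Rightarrow> 'd::finite minkowski) \<Rightarrow> bool" where
  "stationary_in_Q1 M A \<Psi> \<longleftrightarrow> (\<forall>p\<in>topspace M. mean_curvature A \<Psi> p = 0)"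

end

theory Submission
  imports Defs
begin

text \<open>In a chart let \<open>F\<close> be the immersion, \<open>g\<close> the induced metric, \<open>h\<close> its inverse and
  \<open>T = \<Sum>i j. h\<^sup>i\<^sup>j \<partial>\<^sub>i\<partial>\<^sub>j F\<close>. The Christoffel terms of the Laplacian remove from \<open>T\<close> exactly its tangential
  part, so \<open>\<Delta>F = T - T\<^sup>\<top>\<close> componentwise. The trace of the second fundamental form in \<open>Q1\<close> is the same
  vector minus the component of \<open>T\<close> along the unit normal \<open>(0, x)\<close> of \<open>Q1\<close>. Differentiating
  \<open>\<langle>x, \<partial>\<^sub>j x\<rangle> = 0\<close> and tracing with \<open>h\<close>, where \<open>\<langle>\<partial>\<^sub>i x, \<partial>\<^sub>j x\<rangle> = g\<^sub>i\<^sub>j + \<partial>\<^sub>i t \<partial>\<^sub>j t\<close>, shows that this component is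
  \<open>- (k + \<parallel>\<nabla>t\<parallel>\<^sup>2)\<close>. Hence \<open>k\<close> times the mean curvature vector is \<open>\<Delta>F + (k + \<parallel>\<nabla>t\<parallel>\<^sup>2) (0, x)\<close>.\<close>

section \<open>Symmetry of second derivatives\<close>

text \<open>The mean value theorem is applied twice to the second difference over the parallelogram
  with sides \<open>t u\<close> and \<open>t v\<close>: first along \<open>u\<close>, then along
  \<open>v\<close>. It holds only for real values, hence the pairing with \<open>b\<close>.\<close>

lemma second_difference_mean_value:
  fixes F :: "'a::real_normed_vector \<Rightarrow> 'b::real_inner"
  assumes dF: "\<And>y. y \<in> S \<Longrightarrow> F differentiable (at y)"
    and dFu: "\<And>y. y \<in> S \<Longrightarrow> (\<lambda>z. frechet_derivative F (at z) u) differentiable (at y)"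
    and S: "\<And>a c. \<lbrakk>0 \<le> a; a \<le> t; 0 \<le> c; c \<le> t\<rbrakk> \<Longrightarrow> x + a *\<^sub>R u + c *\<^sub>R v \<in> S" and "t > 0"
  obtains a c where "0 \<le> a" "a \<le> t" "0 \<le> c" "c \<le> t"
    "(F (x + t *\<^sub>R u + t *\<^sub>R v) - F (x + t *\<^sub>R u) - F (x + t *\<^sub>R v) + F x) \<bullet> b
      = t\<^sup>2 * (frechet_derivative (\<lambda>z. frechet_derivative F (at z) u) (at (x + a *\<^sub>R u + c *\<^sub>R v)) v \<bullet> b)"
proof -
  define dFu where "dFu = (\<lambda>z. frechet_derivative F (at z) u)"
  have D1: "((\<lambda>s. F (x + s *\<^sub>R u + c *\<^sub>R v) \<bullet> b) has_field_derivative dFu (x + s *\<^sub>R u + c *\<^sub>R v) \<bullet> b) (at s)"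
    if "0 \<le> s" "s \<le> t" "0 \<le> c" "c \<le> t" for s c
  proof -
    let ?y = "x + s *\<^sub>R u + c *\<^sub>R v"
    have F: "(F has_derivative frechet_derivative F (at ?y)) (at ?y)"
      using dF[OF S[OF that]] by (simp add: frechet_derivative_works)
    have A: "((\<lambda>s. x + s *\<^sub>R u + c *\<^sub>R v) has_derivative (\<lambda>h. h *\<^sub>R u)) (at s)"
      by (auto intro!: derivative_eq_intros)
    have "((\<lambda>s. F (x + s *\<^sub>R u + c *\<^sub>R v) \<bullet> b) has_derivative (\<lambda>h. frechet_derivative F (at ?y) (h *\<^sub>R u) \<bullet> b)) (at s)"
      by (intro has_derivative_inner_left has_derivative_compose[OF A F])
    moreover have "frechet_derivative F (at ?y) (h *\<^sub>R u) = h *\<^sub>R dFu ?y" for h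
      using has_derivative_bounded_linear[OF F] unfolding dFu_def by (simp add: linear_simps)
    ultimately show ?thesis by (simp add: has_field_derivative_def mult.commute[of _ "_ \<bullet> _"])
  qed
  have D2: "((\<lambda>s. dFu (x + a *\<^sub>R u + s *\<^sub>R v) \<bullet> b) has_field_derivative frechet_derivative dFu (at (x + a *\<^sub>R u + s *\<^sub>R v)) v \<bullet> b) (at s)"
    if "0 \<le> a" "a \<le> t" "0 \<le> s" "s \<le> t" for s a
  proof -
    let ?y = "x + a *\<^sub>R u + s *\<^sub>R v"
    have F: "(dFu has_derivative frechet_derivative dFu (at ?y)) (at ?y)"
      using dFu[OF S[OF that]] by (simp add: frechet_derivative_works dFu_def)
    have A: "((\<lambda>s. x + a *\<^sub>R u + s *\<^sub>R v) has_derivative (\<lambda>h. h *\<^sub>R v)) (at s)"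
      by (auto intro!: derivative_eq_intros)
    have "((\<lambda>s. dFu (x + a *\<^sub>R u + s *\<^sub>R v) \<bullet> b) has_derivative (\<lambda>h. frechet_derivative dFu (at ?y) (h *\<^sub>R v) \<bullet> b)) (at s)"
      by (intro has_derivative_inner_left has_derivative_compose[OF A F])
    moreover have "frechet_derivative dFu (at ?y) (h *\<^sub>R v) = h *\<^sub>R frechet_derivative dFu (at ?y) v" for h
      using has_derivative_bounded_linear[OF F] by (simp add: linear_simps)
    ultimately show ?thesis by (simp add: has_field_derivative_def mult.commute[of _ "_ \<bullet> _"])
  qed
  \<comment> \<open>The increment in direction \<open>v\<close>, as a function of the position along
    \<open>u\<close>. The term \<open>0 *\<^sub>R v\<close> keeps the shape of \<open>D1\<close>,
    which thus applies to both summands.\<close>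
  define f where "f = (\<lambda>s. F (x + s *\<^sub>R u + t *\<^sub>R v) \<bullet> b - F (x + s *\<^sub>R u + 0 *\<^sub>R v) \<bullet> b)"
  have "(f has_field_derivative (dFu (x + s *\<^sub>R u + t *\<^sub>R v) \<bullet> b - dFu (x + s *\<^sub>R u + 0 *\<^sub>R v) \<bullet> b)) (at s)"
    if "0 \<le> s" "s \<le> t" for s
    unfolding f_def by (intro DERIV_diff D1) (use that \<open>t > 0\<close> in auto)
  from MVT2[OF \<open>t > 0\<close> this] obtain a where a: "0 < a" "a < t"
    "f t - f 0 = (t - 0) * (dFu (x + a *\<^sub>R u + t *\<^sub>R v) \<bullet> b - dFu (x + a *\<^sub>R u + 0 *\<^sub>R v) \<bullet> b)" by blast
  have "((\<lambda>s. dFu (x + a *\<^sub>R u + s *\<^sub>R v) \<bullet> b) has_field_derivative frechet_derivative dFu (at (x + a *\<^sub>R u + s *\<^sub>R v)) v \<bullet> b) (at s)"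
    if "0 \<le> s" "s \<le> t" for s using D2 a that by auto
  from MVT2[OF \<open>t > 0\<close> this] obtain c where c: "0 < c" "c < t"
    "dFu (x + a *\<^sub>R u + t *\<^sub>R v) \<bullet> b - dFu (x + a *\<^sub>R u + 0 *\<^sub>R v) \<bullet> b = (t - 0) * (frechet_derivative dFu (at (x + a *\<^sub>R u + c *\<^sub>R v)) v \<bullet> b)" by blast
  have "(F (x + t *\<^sub>R u + t *\<^sub>R v) - F (x + t *\<^sub>R u) - F (x + t *\<^sub>R v) + F x) \<bullet> b = f t - f 0"
    by (simp add: f_def inner_diff_left inner_add_left)
  also have "\<dots> = t\<^sup>2 * (frechet_derivative dFu (at (x + a *\<^sub>R u + c *\<^sub>R v)) v \<bullet> b)"
    using a(3) c(3) by (simp add: power2_eq_square)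
  finally show ?thesis using that[of a c] a c unfolding dFu_def by simp
qed

text \<open>The second difference is symmetric in \<open>u\<close> and \<open>v\<close>. Expressing
  it in both orders by \<open>second_difference_mean_value\<close> gives mixed derivatives that
  agree, after pairing with \<open>b\<close>, at two points near \<open>x\<close>; continuity
  carries this over to \<open>x\<close>.\<close>

lemma symmetric_second_derivative:
  fixes F :: "'a::real_normed_vector \<Rightarrow> 'b::real_inner"
  assumes "open S" "x \<in> S"
    and dF: "\<And>y. y \<in> S \<Longrightarrow> F differentiable (at y)"
    and dFw: "\<And>y w. y \<in> S \<Longrightarrow> (\<lambda>z. frechet_derivative F (at z) w) differentiable (at y)"
    and cont: "\<And>u v. continuous_on S (\<lambda>y. frechet_derivative (\<lambda>z. frechet_derivative F (at z) u) (at y) v)"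
  shows "frechet_derivative (\<lambda>z. frechet_derivative F (at z) u) (at x) v =
         frechet_derivative (\<lambda>z. frechet_derivative F (at z) v) (at x) u"
proof -
  define E where "E u v y = frechet_derivative (\<lambda>z. frechet_derivative F (at z) u) (at y) v" for u v y
  have near: "\<exists>d>0. ball x d \<subseteq> S \<and> (\<forall>y\<in>ball x d. dist (E u v y) (E u v x) < e)" if e: "e > 0" for e u v
  proof -
    have "continuous_on S (E u v)" using cont unfolding E_def .
    then obtain d where "d > 0" "\<forall>y\<in>S. dist y x < d \<longrightarrow> dist (E u v y) (E u v x) < e"
      using \<open>x \<in> S\<close> e unfolding continuous_on_iff by meson
    moreover obtain d' where "d' > 0" "ball x d' \<subseteq> S" using assms(1,2) openE by blast
    ultimately show ?thesis
      by (intro exI[of _ "min d d'"]) (auto simp: dist_commute subset_eq)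
  qed
  have "(E u v x - E v u x) \<bullet> b = 0" for b
  proof (rule ccontr)
    assume ne: "(E u v x - E v u x) \<bullet> b \<noteq> 0"
    \<comment> \<open>Two errors of at most \<open>e * norm b\<close> must not add up to the assumed
      gap; the summand 1 makes that estimate strict.\<close>
    define e where "e = \<bar>(E u v x - E v u x) \<bullet> b\<bar> / (2 * (norm b + 1))"
    have "e > 0" using ne by (simp add: e_def add_nonneg_pos)
    obtain d1 where d1: "d1 > 0" "ball x d1 \<subseteq> S" "\<forall>y\<in>ball x d1. dist (E u v y) (E u v x) < e"
      using near[OF \<open>e > 0\<close>] by blast
    obtain d2 where d2: "d2 > 0" "ball x d2 \<subseteq> S" "\<forall>y\<in>ball x d2. dist (E v u y) (E v u x) < e"
      using near[OF \<open>e > 0\<close>] by blast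
    define d where "d = min d1 d2"
    \<comment> \<open>So small that the whole parallelogram lies in \<open>ball x d\<close>, even if
      \<open>u\<close> and \<open>v\<close> both vanish.\<close>
    define t where "t = d / (2 * (norm u + norm v + 1))"
    have t: "t > 0" using d1 d2 by (simp add: t_def d_def add_nonneg_pos)
    have bound: "x + a *\<^sub>R u + c *\<^sub>R v \<in> ball x d" if "0 \<le> a" "a \<le> t" "0 \<le> c" "c \<le> t" for a c
    proof -
      have "norm (a *\<^sub>R u + c *\<^sub>R v) \<le> a * norm u + c * norm v"
        using norm_triangle_ineq[of "a *\<^sub>R u" "c *\<^sub>R v"] that by simp
      also have "\<dots> \<le> t * norm u + t * norm v" using that by (intro add_mono mult_right_mono) auto
      also have "\<dots> < t * (2 * (norm u + norm v + 1))"
        using t by (simp add: algebra_simps add_nonneg_pos)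
      also have "\<dots> = d"
        using add_nonneg_pos[of "norm u + norm v" 1] by (simp add: t_def)
      finally have "dist (x + (a *\<^sub>R u + c *\<^sub>R v)) x < d" by (simp add: dist_norm)
      then show ?thesis by (simp add: dist_commute add.assoc)
    qed
    have bS: "x + a *\<^sub>R u + c *\<^sub>R v \<in> S" if "0 \<le> a" "a \<le> t" "0 \<le> c" "c \<le> t" for a c
      using bound[OF that] d1 by (auto simp: d_def)
    have bS': "x + a *\<^sub>R v + c *\<^sub>R u \<in> S" if "0 \<le> a" "a \<le> t" "0 \<le> c" "c \<le> t" for a c
      using bS[OF that(3,4,1,2)] by (simp add: add_ac)
    obtain a c where ac: "0 \<le> a" "a \<le> t" "0 \<le> c" "c \<le> t"
      "(F (x + t *\<^sub>R u + t *\<^sub>R v) - F (x + t *\<^sub>R u) - F (x + t *\<^sub>R v) + F x) \<bullet> b = t\<^sup>2 * (E u v (x + a *\<^sub>R u + c *\<^sub>R v) \<bullet> b)"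
      by (rule second_difference_mean_value[OF dF dFw bS t, folded E_def, where b = b]) blast
    obtain p q where pq: "0 \<le> p" "p \<le> t" "0 \<le> q" "q \<le> t"
      "(F (x + t *\<^sub>R v + t *\<^sub>R u) - F (x + t *\<^sub>R v) - F (x + t *\<^sub>R u) + F x) \<bullet> b = t\<^sup>2 * (E v u (x + p *\<^sub>R v + q *\<^sub>R u) \<bullet> b)"
      by (rule second_difference_mean_value[OF dF dFw bS' t, folded E_def, where b = b]) blast
    \<comment> \<open>In the second application \<open>u\<close> and \<open>v\<close> are exchanged,
      so \<open>q\<close> is the parameter along \<open>u\<close> and \<open>p\<close> the one along
      \<open>v\<close>.\<close>
    define y z where "y = x + a *\<^sub>R u + c *\<^sub>R v" and "z = x + q *\<^sub>R u + p *\<^sub>R v"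
    have eq: "E u v y \<bullet> b = E v u z \<bullet> b"
      using ac(5) pq(5) t unfolding y_def z_def by (simp add: add_ac diff_diff_eq inner_diff_left inner_add_left)
    have "y \<in> ball x d1" "z \<in> ball x d2"
      using bound[OF ac(1-4)] bound[OF pq(3,4,1,2)] by (auto simp: y_def z_def d_def)
    then have nd: "norm (E u v x - E u v y) < e" "norm (E v u z - E v u x) < e"
      using d1 d2 by (auto simp: dist_norm norm_minus_commute)
    have "(E u v x - E v u x) \<bullet> b = (E u v x - E u v y) \<bullet> b + (E v u z - E v u x) \<bullet> b"
      using eq by (simp add: inner_diff_left)
    then have "\<bar>(E u v x - E v u x) \<bullet> b\<bar> \<le> norm (E u v x - E u v y) * norm b + norm (E v u z - E v u x) * norm b"
      using Cauchy_Schwarz_ineq2[of "E u v x - E u v y" b] Cauchy_Schwarz_ineq2[of "E v u z - E v u x" b] by linarith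
    also have "\<dots> \<le> e * norm b + e * norm b"
      using nd by (intro add_mono mult_right_mono) auto
    also have "\<dots> < e * (2 * (norm b + 1))" using \<open>e > 0\<close> by (simp add: algebra_simps)
    also have "\<dots> = \<bar>(E u v x - E v u x) \<bullet> b\<bar>"
      using add_nonneg_pos[of "norm b" 1] by (simp add: e_def)
    finally show False by simp
  qed
  then have "E u v x - E v u x = 0" using inner_eq_zero_iff by blast
  then show ?thesis by (simp add: E_def)
qed

section \<open>The Laplacian in coordinates\<close>

lemma partial_deriv_eq: "(f has_derivative f') (at x) \<Longrightarrow> partial_deriv i f x = f' (axis i 1)"
  unfolding partial_deriv_def using frechet_derivative_at by metis

lemma partial_deriv_cong:
  assumes "open S" "x \<in> S" "\<And>y. y \<in> S \<Longrightarrow> f y = g y"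
  shows "partial_deriv i f x = partial_deriv i g x"
proof -
  \<comment> \<open>\<open>frechet_derivative\<close> is a choice among all derivatives, so it
    suffices that both functions have the same derivatives at \<open>x\<close>.\<close>
  have "(f has_derivative f') (at x) \<longleftrightarrow> (g has_derivative f') (at x)" for f'
    using has_derivative_transform_within_open[OF _ assms(1,2)] assms(3) by (metis (no_types, lifting))
  then show ?thesis by (simp add: partial_deriv_def frechet_derivative_def)
qed

lemma
  fixes A :: "'a::semiring_1^'n^'m"
  assumes "invertible A"
  shows matrix_inv_right: "A ** matrix_inv A = mat 1" and matrix_inv_left: "matrix_inv A ** A = mat 1"
  using someI_ex[OF assms[unfolded invertible_def]] by (auto simp: matrix_inv_def)

lemma differentiable_det:
  fixes M :: "'a::real_normed_vector \<Rightarrow> real^'n^'n"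
  assumes "\<And>i j. (\<lambda>y. M y $ i $ j) differentiable (at x)"
  shows "(\<lambda>y. det (M y)) differentiable (at x)"
proof -
  have M: "((\<lambda>y. M y $ i $ j) has_derivative frechet_derivative (\<lambda>y. M y $ i $ j) (at x)) (at x)" for i j
    using assms by (simp add: frechet_derivative_works)
  have "(\<lambda>y. \<Prod>i\<in>UNIV. M y $ i $ p i) differentiable (at x)" for p
    unfolding differentiable_def by (rule exI, rule has_derivative_prod, rule M)
  then show ?thesis
    unfolding det_def by (intro differentiable_sum differentiable_mult differentiable_const) auto
qed

text \<open>By Cramer's rule each component of the solution of \<open>g X = b\<close> is, throughout
  \<open>S\<close>, a quotient of two determinants with differentiable entries.\<close>

lemma differentiable_matrix_inv_mult:
  fixes g :: "'a::real_normed_vector \<Rightarrow> real^'n^'n" and b :: "'a \<Rightarrow> real^'n"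
  assumes "open S" "x \<in> S" and inv: "\<And>y. y \<in> S \<Longrightarrow> invertible (g y)"
    and g: "\<And>i j. (\<lambda>y. g y $ i $ j) differentiable (at x)"
    and b: "\<And>i. (\<lambda>y. b y $ i) differentiable (at x)"
  shows "(\<lambda>y. (matrix_inv (g y) *v b y) $ k) differentiable (at x)"
proof -
  define c where "c y = det (\<chi> i j. if j = k then b y $ i else g y $ i $ j) / det (g y)" for y
  have eq: "(matrix_inv (g y) *v b y) $ k = c y" if "y \<in> S" for y
  proof -
    have "g y *v (matrix_inv (g y) *v b y) = b y"
      using inv[OF that] by (simp add: matrix_vector_mul_assoc matrix_inv_right)
    then show ?thesis
      using cramer[of "g y" "matrix_inv (g y) *v b y" "b y"] inv[OF that] by (simp add: c_def invertible_det_nz)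
  qed
  have "(\<lambda>y. if j = k then b y $ i else g y $ i $ j) differentiable (at x)" for i j
    using g b by (cases "j = k") auto
  then have "c differentiable (at x)"
    unfolding c_def using inv[OF \<open>x \<in> S\<close>] g
    by (intro differentiable_divide differentiable_det) (auto simp: invertible_det_nz)
  then obtain c' where "(c has_derivative c') (at x)" by (auto simp: differentiable_def)
  then have "((\<lambda>y. (matrix_inv (g y) *v b y) $ k) has_derivative c') (at x)"
    by (rule has_derivative_transform_within_open[OF _ assms(1,2)]) (simp add: eq)
  then show ?thesis by (auto simp: differentiable_def)
qed

lemma matrix_inv_symmetric:
  fixes A :: "real^'n^'n"
  assumes "invertible A" "transpose A = A"
  shows "matrix_inv A $ i $ j = matrix_inv A $ j $ i"
proof -
  have "transpose (matrix_inv A) = transpose (matrix_inv A) ** (A ** matrix_inv A)"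
    using assms(1) by (simp add: matrix_inv_right)
  also have "\<dots> = transpose (A ** matrix_inv A) ** matrix_inv A"
    using assms(2) by (simp add: matrix_transpose_mul matrix_mul_assoc)
  also have "\<dots> = matrix_inv A"
    using assms(1) by (simp add: matrix_inv_right)
  finally have "transpose (matrix_inv A) $ j $ i = matrix_inv A $ j $ i" by simp
  then show ?thesis by (simp add: transpose_def)
qed

text \<open>For a metric \<open>g\<close> and the differential \<open>b\<close> of a function,
  \<open>X\<close> is the gradient and the left side its divergence. The right side is free of
  derivatives of the inverse metric, so it can be computed from the first derivatives of
  \<open>g\<close> and \<open>b\<close> alone.\<close>

lemma laplacian_in_coordinates:
  fixes g :: "real^'k::finite \<Rightarrow> real^'k^'k" and b :: "real^'k \<Rightarrow> real^'k"
  assumes "open S" "x \<in> S" and inv: "\<And>y. y \<in> S \<Longrightarrow> invertible (g y)"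
    and sym: "\<And>y. y \<in> S \<Longrightarrow> transpose (g y) = g y"
    and g: "\<And>i j. (\<lambda>y. g y $ i $ j) differentiable (at x)"
    and b: "\<And>i. (\<lambda>y. b y $ i) differentiable (at x)"
  defines "h \<equiv> matrix_inv (g x)" and "X \<equiv> \<lambda>y. matrix_inv (g y) *v b y"
  shows "(\<Sum>i\<in>UNIV. partial_deriv i (\<lambda>y. X y $ i) x + (\<Sum>l\<in>UNIV. christoffel g i i l x * X x $ l))
    = (\<Sum>i\<in>UNIV. \<Sum>j\<in>UNIV. h $ i $ j * (partial_deriv i (\<lambda>y. b y $ j) x
        - (\<Sum>l\<in>UNIV. (partial_deriv i (\<lambda>y. g y $ j $ l) x - partial_deriv l (\<lambda>y. g y $ i $ j) x / 2) * X x $ l)))"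
proof -
  define dg where "dg i j l = partial_deriv i (\<lambda>y. g y $ j $ l) x" for i j l
  define dX where "dX i j = partial_deriv i (\<lambda>y. X y $ j) x" for i j
  define db where "db i j = partial_deriv i (\<lambda>y. b y $ j) x" for i j
  have hsym: "h $ i $ j = h $ j $ i" for i j
    unfolding h_def using matrix_inv_symmetric inv sym \<open>x \<in> S\<close> by blast
  have Xd: "(\<lambda>y. X y $ j) differentiable (at x)" for j
    unfolding X_def using differentiable_matrix_inv_mult[OF assms(1,2) inv g b] .
  \<comment> \<open>Differentiating \<open>g X = b\<close> avoids the derivative of the inverse matrix.\<close>
  have key: "db i j = (\<Sum>l\<in>UNIV. g x $ j $ l * dX i l + dg i j l * X x $ l)" for i j
  proof -
    have "db i j = partial_deriv i (\<lambda>y. \<Sum>l\<in>UNIV. g y $ j $ l * X y $ l) x"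
      unfolding db_def
    proof (rule partial_deriv_cong[OF assms(1,2)])
      fix y assume "y \<in> S"
      then have "g y *v X y = b y"
        unfolding X_def using inv by (simp add: matrix_vector_mul_assoc matrix_inv_right)
      then show "b y $ j = (\<Sum>l\<in>UNIV. g y $ j $ l * X y $ l)"
        by (simp add: vec_eq_iff matrix_vector_mult_def)
    qed
    also have "\<dots> = (\<Sum>l\<in>UNIV. g x $ j $ l * dX i l + dg i j l * X x $ l)"
      unfolding dX_def dg_def partial_deriv_def[of i "\<lambda>y. g y $ j $ _"] partial_deriv_def[of i "\<lambda>y. X y $ _"]
      by (intro partial_deriv_eq has_derivative_sum has_derivative_mult)
         (use g Xd in \<open>simp_all add: frechet_derivative_works\<close>)
    finally show ?thesis .
  qed
  have hg: "(\<Sum>j\<in>UNIV. h $ i $ j * g x $ j $ l) = (if i = l then 1 else 0)" for i l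
  proof -
    have "(h ** g x) $ i $ l = mat 1 $ i $ l" unfolding h_def using inv \<open>x \<in> S\<close> by (simp add: matrix_inv_left)
    then show ?thesis by (simp add: matrix_matrix_mult_def mat_def)
  qed
  \<comment> \<open>Contracting \<open>key\<close> with \<open>h\<close> cancels the factor
    \<open>g x\<close> and isolates the derivative of \<open>X\<close>.\<close>
  have dX: "dX i i = (\<Sum>j\<in>UNIV. h $ i $ j * (db i j - (\<Sum>l\<in>UNIV. dg i j l * X x $ l)))" for i
  proof -
    have "(\<Sum>j\<in>UNIV. h $ i $ j * (db i j - (\<Sum>l\<in>UNIV. dg i j l * X x $ l)))
        = (\<Sum>j\<in>UNIV. \<Sum>l\<in>UNIV. h $ i $ j * g x $ j $ l * dX i l)"
      by (simp add: key sum.distrib sum_distrib_left mult.assoc)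
    also have "\<dots> = (\<Sum>l\<in>UNIV. (\<Sum>j\<in>UNIV. h $ i $ j * g x $ j $ l) * dX i l)"
      by (subst sum.swap) (simp add: sum_distrib_right)
    also have "\<dots> = dX i i" by (simp add: hg if_distrib[of "\<lambda>z. z * _"] cong: if_cong)
    finally show ?thesis by simp
  qed
  \<comment> \<open>In the contracted Christoffel symbol the first and third terms cancel by the
    symmetry of \<open>h\<close> and \<open>g\<close>.\<close>
  have trace: "(\<Sum>i\<in>UNIV. christoffel g i i l x) = (\<Sum>i\<in>UNIV. \<Sum>j\<in>UNIV. h $ i $ j * dg l i j / 2)" for l
  proof -
    have "(\<Sum>i\<in>UNIV. \<Sum>j\<in>UNIV. h $ i $ j * dg i l j) = (\<Sum>i\<in>UNIV. \<Sum>j\<in>UNIV. h $ i $ j * dg j i l)"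
    proof -
      have "dg i l j = dg i j l" for i j
        unfolding dg_def
      proof (rule partial_deriv_cong[OF assms(1,2)])
        fix y assume "y \<in> S"
        then have "transpose (g y) $ l $ j = g y $ l $ j" using sym by simp
        then show "g y $ l $ j = g y $ j $ l" by (simp add: transpose_def)
      qed
      then show ?thesis by (subst sum.swap) (simp add: hsym)
    qed
    moreover have "christoffel g i i l x = ((\<Sum>j\<in>UNIV. h $ i $ j * dg i l j) + (\<Sum>j\<in>UNIV. h $ i $ j * dg l i j)
        - (\<Sum>j\<in>UNIV. h $ i $ j * dg j i l)) / 2" for i
      by (simp add: christoffel_def dg_def h_def distrib_left right_diff_distrib sum.distrib sum_subtractf)
    then have "(\<Sum>i\<in>UNIV. christoffel g i i l x)
      = ((\<Sum>i\<in>UNIV. \<Sum>j\<in>UNIV. h $ i $ j * dg i l j) + (\<Sum>i\<in>UNIV. \<Sum>j\<in>UNIV. h $ i $ j * dg l i j)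
        - (\<Sum>i\<in>UNIV. \<Sum>j\<in>UNIV. h $ i $ j * dg j i l)) / 2"
      by (simp only: sum_divide_distrib[symmetric] sum.distrib sum_subtractf)
    ultimately show ?thesis by (simp add: sum_divide_distrib)
  qed
  have "(\<Sum>i\<in>UNIV. dX i i + (\<Sum>l\<in>UNIV. christoffel g i i l x * X x $ l))
    = (\<Sum>i\<in>UNIV. dX i i) + (\<Sum>l\<in>UNIV. (\<Sum>i\<in>UNIV. christoffel g i i l x) * X x $ l)"
    unfolding sum.distrib sum_distrib_right by (simp, rule sum.swap)
  also have "(\<Sum>l\<in>UNIV. (\<Sum>i\<in>UNIV. christoffel g i i l x) * X x $ l)
    = (\<Sum>i\<in>UNIV. \<Sum>j\<in>UNIV. \<Sum>l\<in>UNIV. h $ i $ j * (dg l i j / 2 * X x $ l))"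
    unfolding trace sum_distrib_right
    by (subst sum.swap, rule sum.cong[OF refl], subst sum.swap) (simp add: mult_ac)
  also have "(\<Sum>i\<in>UNIV. dX i i) + \<dots> = (\<Sum>i\<in>UNIV. \<Sum>j\<in>UNIV. h $ i $ j * (db i j - (\<Sum>l\<in>UNIV. (dg i j l - dg l i j / 2) * X x $ l)))"
    unfolding dX sum.distrib[symmetric]
    by (intro sum.cong refl) (simp add: left_diff_distrib right_diff_distrib sum_subtractf sum_distrib_left)
  finally show ?thesis unfolding dX_def db_def dg_def .
qed

section \<open>Orthogonal projections in Minkowski space\<close>

text \<open>Provides the linearity rules for \<open>lorentz\<close> and the product rule by which
  the induced metric is differentiated.\<close>

lemma bounded_bilinear_lorentz: "bounded_bilinear (lorentz :: 'd::finite minkowski \<Rightarrow> _)"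
proof
  show "\<exists>K. \<forall>u v :: 'd minkowski. norm (lorentz u v) \<le> norm u * norm v * K"
  proof (intro exI allI)
    fix u v :: "'d minkowski"
    have "\<bar>fst u * fst v\<bar> \<le> norm u * norm v"
      using mult_mono[OF norm_fst_le[of "fst u" "snd u"] norm_fst_le[of "fst v" "snd v"]] by (simp add: abs_mult)
    moreover have "\<bar>snd u \<bullet> snd v\<bar> \<le> norm u * norm v"
      using order_trans[OF Cauchy_Schwarz_ineq2 mult_mono[OF norm_snd_le[of "snd u" "fst u"] norm_snd_le[of "snd v" "fst v"]]] by simp
    ultimately show "norm (lorentz u v) \<le> norm u * norm v * 2"
      by (simp add: lorentz_def abs_le_iff)
  qed
qed (simp_all add: lorentz_def algebra_simps inner_add_left inner_add_right)

interpretation lorentz: bounded_bilinear "lorentz :: 'd::finite minkowski \<Rightarrow> _"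
  by (rule bounded_bilinear_lorentz)

lemma lorentz_commute: "lorentz u v = lorentz v u"
  by (simp add: lorentz_def inner_commute mult.commute)

text \<open>Two candidates for the projection differ by a vector of \<open>S\<close> orthogonal to
  all of \<open>S\<close>, which nondegeneracy forces to vanish.\<close>

lemma lorentz_proj_eqI:
  assumes "subspace S" and nondeg: "\<And>w. w \<in> S \<Longrightarrow> (\<And>z. z \<in> S \<Longrightarrow> lorentz w z = 0) \<Longrightarrow> w = 0"
    and u: "u \<in> S" "\<And>w. w \<in> S \<Longrightarrow> lorentz (v - u) w = 0"
  shows "lorentz_proj S v = u"
  unfolding lorentz_proj_def
proof (rule the_equality)
  fix u' assume u': "u' \<in> S \<and> (\<forall>w\<in>S. lorentz (v - u') w = 0)"
  have "lorentz (u' - u) w = lorentz (v - u) w - lorentz (v - u') w" for w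
    by (simp add: lorentz.diff_left)
  then have "u' - u = 0"
    using u' u assms(1) by (intro nondeg subspace_diff) auto
  then show "u' = u" by simp
qed (use u in auto)

text \<open>The vector \<open>(0, snd q)\<close> is a spacelike unit normal of \<open>Q1\<close> at
  \<open>q\<close>, so projecting means subtracting the component along it.\<close>

lemma lorentz_proj_tangent_Q1:
  assumes "q \<in> Q1"
  shows "lorentz_proj (tangent_Q1 q) v = v - (snd q \<bullet> snd v) *\<^sub>R (0, snd q)"
proof (rule lorentz_proj_eqI)
  have T: "tangent_Q1 q = {v. snd q \<bullet> snd v = 0}"
    by (simp add: tangent_Q1_def inner_vec_def)
  show "subspace (tangent_Q1 q)"
    unfolding T by (auto simp: subspace_def inner_add_right)
  show "w = 0" if "w \<in> tangent_Q1 q" "\<And>z. z \<in> tangent_Q1 q \<Longrightarrow> lorentz w z = 0" for w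
  proof -
    \<comment> \<open>Reversing the time component preserves tangency, and the Lorentzian product
      with \<open>w\<close> becomes the Euclidean square of \<open>w\<close>.\<close>
    have "(- fst w, snd w) \<in> tangent_Q1 q" using that(1) by (simp add: T)
    from that(2)[OF this] have "fst w * fst w + snd w \<bullet> snd w = 0" by (simp add: lorentz_def)
    then show ?thesis
      by (metis add_nonneg_eq_0_iff inner_ge_zero inner_eq_zero_iff zero_le_square mult_eq_0_iff prod.expand fst_zero snd_zero)
  qed
  have "snd q \<bullet> snd q = 1"
    using assms by (auto simp: Q1_def inner_vec_def power2_eq_square)
  then show "v - (snd q \<bullet> snd v) *\<^sub>R (0, snd q) \<in> tangent_Q1 q"
    by (simp add: T inner_diff_right)
  show "lorentz (v - (v - (snd q \<bullet> snd v) *\<^sub>R (0, snd q))) w = 0" if "w \<in> tangent_Q1 q" for w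
    using that by (simp add: T lorentz_def)
qed

section \<open>Spacelike immersions into the static Einstein spacetime\<close>

text \<open>The immersion read in a single chart, so that all computations take place on an open
  subset of Euclidean space.\<close>

locale spacelike_parametrization =
  fixes F :: "real^'k::finite \<Rightarrow> 'd::finite minkowski" and U :: "(real^'k) set"
  assumes open_U: "open U" and C2: "Ck_on 2 U F" and F_Q1: "F ` U \<subseteq> Q1"
    and pos: "\<And>y v. y \<in> U \<Longrightarrow> v \<noteq> 0 \<Longrightarrow>
      v \<bullet> ((\<chi> i j. lorentz (partial_deriv i F y) (partial_deriv j F y)) *v v) > 0"
begin

definition g :: "real^'k \<Rightarrow> real^'k^'k" where
  "g y = (\<chi> i j. lorentz (partial_deriv i F y) (partial_deriv j F y))"

abbreviation h :: "real^'k \<Rightarrow> real^'k^'k" where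
  "h y \<equiv> matrix_inv (g y)"

definition D2 :: "'k \<Rightarrow> 'k \<Rightarrow> real^'k \<Rightarrow> 'd minkowski" where
  "D2 i j = partial_deriv i (partial_deriv j F)"

definition trace_D2 :: "real^'k \<Rightarrow> 'd minkowski" where
  "trace_D2 x = (\<Sum>i\<in>UNIV. \<Sum>j\<in>UNIV. (h x $ i $ j) *\<^sub>R D2 i j x)"

text \<open>The orthogonal projection of \<open>v\<close> to the image of the differential, expanded
  in the coordinate basis; \<open>lorentz_proj_range_dF\<close> justifies this. The explicit form
  makes linearity in \<open>v\<close> evident.\<close>

definition tangential :: "real^'k \<Rightarrow> 'd minkowski \<Rightarrow> 'd minkowski" where
  "tangential x v = (\<Sum>i\<in>UNIV. \<Sum>j\<in>UNIV. (h x $ i $ j * lorentz v (partial_deriv i F x)) *\<^sub>R partial_deriv j F x)"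

lemma F_differentiable: "y \<in> U \<Longrightarrow> F differentiable (at y)"
  and dF_differentiable: "y \<in> U \<Longrightarrow> (\<lambda>z. frechet_derivative F (at z) v) differentiable (at y)"
  and D2F_continuous: "continuous_on U (\<lambda>y. frechet_derivative (\<lambda>z. frechet_derivative F (at z) v) (at y) w)"
  using C2 by (auto simp: numeral_2_eq_2)

lemma F_has_derivative: "y \<in> U \<Longrightarrow> (F has_derivative frechet_derivative F (at y)) (at y)"
  using F_differentiable by (simp add: frechet_derivative_works)

lemma D_has_derivative:
  "y \<in> U \<Longrightarrow> (partial_deriv j F has_derivative frechet_derivative (partial_deriv j F) (at y)) (at y)"
  using dF_differentiable[of y "axis j 1"] by (simp add: frechet_derivative_works partial_deriv_def[abs_def])

lemma D2_commute: "x \<in> U \<Longrightarrow> D2 i j x = D2 j i x"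
  using symmetric_second_derivative[OF open_U _ F_differentiable dF_differentiable D2F_continuous]
  by (simp add: D2_def partial_deriv_def[abs_def])

lemma partial_deriv_linear_D:
  "bounded_linear L \<Longrightarrow> x \<in> U \<Longrightarrow> partial_deriv i (\<lambda>y. L (partial_deriv j F y)) x = L (D2 i j x)"
  using partial_deriv_eq[OF bounded_linear.has_derivative[OF _ D_has_derivative]]
  by (metis D2_def partial_deriv_def)

section \<open>The induced metric and its derivatives\<close>

lemma g_sym: "transpose (g y) = g y"
  by (simp add: g_def transpose_def lorentz_commute vec_eq_iff)

lemma g_invertible: "y \<in> U \<Longrightarrow> invertible (g y)"
proof -
  assume "y \<in> U"
  then have "v = 0" if "g y *v v = 0" for v
    using pos[of y v] that by (force simp: g_def)
  then show ?thesis
    by (simp add: invertible_left_inverse matrix_left_invertible_ker)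
qed

lemma h_sym: "y \<in> U \<Longrightarrow> h y $ i $ j = h y $ j $ i"
  using matrix_inv_symmetric g_sym g_invertible by blast

lemma h_g: "y \<in> U \<Longrightarrow> (\<Sum>j\<in>UNIV. h y $ i $ j * lorentz (partial_deriv j F y) (partial_deriv l F y)) = (if i = l then 1 else 0)"
proof -
  assume "y \<in> U"
  then have "(h y ** g y) $ i $ l = mat 1 $ i $ l" using g_invertible by (simp add: matrix_inv_left)
  then show ?thesis by (simp add: matrix_matrix_mult_def mat_def g_def)
qed

lemma g_has_derivative:
  "y \<in> U \<Longrightarrow> ((\<lambda>y. g y $ i $ j) has_derivative (\<lambda>v. lorentz (partial_deriv i F y) (frechet_derivative (partial_deriv j F) (at y) v)
     + lorentz (frechet_derivative (partial_deriv i F) (at y) v) (partial_deriv j F y))) (at y)"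
  unfolding g_def by (simp add: lorentz.FDERIV[OF D_has_derivative D_has_derivative])

lemma partial_deriv_g:
  "x \<in> U \<Longrightarrow> partial_deriv m (\<lambda>y. g y $ i $ j) x = lorentz (partial_deriv i F x) (D2 m j x) + lorentz (D2 m i x) (partial_deriv j F x)"
  using partial_deriv_eq[OF g_has_derivative] by (simp add: D2_def partial_deriv_def)

text \<open>Here \<open>X\<close> is the gradient of \<open>L\<close> composed with
  \<open>F\<close>, and taking coordinate functionals for \<open>L\<close> covers all components of
  the immersion. The derivative of the differential contributes \<open>L (trace_D2 x)\<close>; the
  derivatives of the metric pair \<open>trace_D2 x\<close> with the coordinate fields and so yield
  its tangential part.\<close>

lemma laplacian_linear:
  assumes L: "bounded_linear L" and x: "x \<in> U"
  defines "X \<equiv> \<lambda>y. h y *v (\<chi> j. L (partial_deriv j F y))"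
  shows "(\<Sum>i\<in>UNIV. partial_deriv i (\<lambda>y. X y $ i) x + (\<Sum>l\<in>UNIV. christoffel g i i l x * X x $ l))
    = L (trace_D2 x - tangential x (trace_D2 x))"
proof -
  interpret L: bounded_linear L by (rule L)
  have Xl: "X x $ l = (\<Sum>m\<in>UNIV. h x $ m $ l * L (partial_deriv m F x))" for l
    unfolding X_def by (simp add: matrix_vector_mult_def h_sym[OF x, of l])
  \<comment> \<open>The Christoffel symbols of the induced metric with the upper index lowered to
    the last place.\<close>
  define a where "a l i j = lorentz (D2 l i x) (partial_deriv j F x)" for l i j
  \<comment> \<open>Since \<open>a l i j\<close> and \<open>a l j i\<close> have the same trace, the derivatives of the metric contribute only \<open>a i j l\<close>.\<close>
  have a_trace: "(\<Sum>i\<in>UNIV. \<Sum>j\<in>UNIV. h x $ i $ j * a l j i) = (\<Sum>i\<in>UNIV. \<Sum>j\<in>UNIV. h x $ i $ j * a l i j)" for l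
    by (subst sum.swap) (simp add: h_sym[OF x])
  have tr: "(\<Sum>i\<in>UNIV. \<Sum>j\<in>UNIV. h x $ i $ j * a i j l) = lorentz (trace_D2 x) (partial_deriv l F x)" for l
    unfolding trace_D2_def a_def by (simp add: lorentz.sum_left lorentz.scaleR_left)
  \<comment> \<open>Symmetry of second derivatives turns \<open>a i l j\<close> into
    \<open>a l i j\<close>; what remains beside \<open>a i j l\<close> is antisymmetric in
    \<open>i\<close> and \<open>j\<close>.\<close>
  have dg: "partial_deriv i (\<lambda>y. g y $ j $ l) x - partial_deriv l (\<lambda>y. g y $ i $ j) x / 2
     = a i j l + (a l i j - a l j i) / 2" for i j l
    using x D2_commute[OF x, of i l] by (simp add: partial_deriv_g a_def lorentz_commute[of "partial_deriv _ F x"] field_simps)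
  have "(\<Sum>i\<in>UNIV. partial_deriv i (\<lambda>y. X y $ i) x + (\<Sum>l\<in>UNIV. christoffel g i i l x * X x $ l))
    = (\<Sum>i\<in>UNIV. \<Sum>j\<in>UNIV. h x $ i $ j * (partial_deriv i (\<lambda>y. (\<chi> j. L (partial_deriv j F y)) $ j) x
        - (\<Sum>l\<in>UNIV. (partial_deriv i (\<lambda>y. g y $ j $ l) x - partial_deriv l (\<lambda>y. g y $ i $ j) x / 2) * X x $ l)))"
    unfolding X_def
  proof (rule laplacian_in_coordinates[OF open_U x g_invertible g_sym])
    show "(\<lambda>y. g y $ i $ j) differentiable at x" for i j
      using g_has_derivative[OF x] unfolding differentiable_def by blast
    show "(\<lambda>y. (\<chi> j. L (partial_deriv j F y)) $ i) differentiable at x" for i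
      using bounded_linear.has_derivative[OF L D_has_derivative[OF x]] unfolding differentiable_def by auto
  qed
  also have "\<dots> = (\<Sum>i\<in>UNIV. \<Sum>j\<in>UNIV. h x $ i $ j * L (D2 i j x))
      - (\<Sum>i\<in>UNIV. \<Sum>j\<in>UNIV. \<Sum>l\<in>UNIV. h x $ i $ j * (a i j l + (a l i j - a l j i) / 2) * X x $ l)"
    by (simp add: dg partial_deriv_linear_D[OF L x] right_diff_distrib sum_subtractf sum_distrib_left mult.assoc)
  also have "(\<Sum>i\<in>UNIV. \<Sum>j\<in>UNIV. \<Sum>l\<in>UNIV. h x $ i $ j * (a i j l + (a l i j - a l j i) / 2) * X x $ l)
    = (\<Sum>l\<in>UNIV. (\<Sum>i\<in>UNIV. \<Sum>j\<in>UNIV. h x $ i $ j * (a i j l + (a l i j - a l j i) / 2)) * X x $ l)"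
    unfolding sum_distrib_right by (subst (3) sum.swap, subst (2) sum.swap) (rule refl)
  also have "\<dots> = (\<Sum>l\<in>UNIV. lorentz (trace_D2 x) (partial_deriv l F x) * X x $ l)"
  proof (rule sum.cong[OF refl])
    fix l
    have "(\<Sum>i\<in>UNIV. \<Sum>j\<in>UNIV. h x $ i $ j * (a i j l + (a l i j - a l j i) / 2))
      = (\<Sum>i\<in>UNIV. \<Sum>j\<in>UNIV. h x $ i $ j * a i j l)
        + ((\<Sum>i\<in>UNIV. \<Sum>j\<in>UNIV. h x $ i $ j * a l i j) - (\<Sum>i\<in>UNIV. \<Sum>j\<in>UNIV. h x $ i $ j * a l j i)) / 2"
      by (simp add: sum_divide_distrib sum.distrib[symmetric] sum_subtractf[symmetric] algebra_simps diff_divide_distrib)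
    then show "(\<Sum>i\<in>UNIV. \<Sum>j\<in>UNIV. h x $ i $ j * (a i j l + (a l i j - a l j i) / 2)) * X x $ l
      = lorentz (trace_D2 x) (partial_deriv l F x) * X x $ l"
      by (simp add: a_trace tr)
  qed
  also have "\<dots> = L (tangential x (trace_D2 x))"
    unfolding tangential_def Xl
    by (simp add: L.sum L.scaleR sum_distrib_left h_sym[OF x] mult_ac)
  also have "(\<Sum>i\<in>UNIV. \<Sum>j\<in>UNIV. h x $ i $ j * L (D2 i j x)) = L (trace_D2 x)"
    unfolding trace_D2_def by (simp add: L.sum L.scaleR)
  finally show ?thesis by (simp add: L.diff)
qed

section \<open>Projection onto the image of the differential\<close>

lemma dF_sum: "x \<in> U \<Longrightarrow> frechet_derivative F (at x) v = (\<Sum>i\<in>UNIV. (v $ i) *\<^sub>R partial_deriv i F x)"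
proof -
  assume "x \<in> U"
  then interpret bounded_linear "frechet_derivative F (at x)"
    using F_has_derivative has_derivative_bounded_linear by blast
  have "v = (\<Sum>i\<in>UNIV. (v $ i) *\<^sub>R axis i 1)"
    using basis_expansion[of v] by (simp add: scalar_mult_eq_scaleR)
  then have "frechet_derivative F (at x) v = frechet_derivative F (at x) (\<Sum>i\<in>UNIV. (v $ i) *\<^sub>R axis i 1)" by simp
  also have "\<dots> = (\<Sum>i\<in>UNIV. (v $ i) *\<^sub>R partial_deriv i F x)"
    by (simp only: sum scaleR partial_deriv_def)
  finally show ?thesis .
qed

text \<open>The product of \<open>w\<close> with itself is the induced metric on a preimage of
  \<open>w\<close>, which is positive definite.\<close>

lemma range_dF_nondegenerate:
  assumes "x \<in> U" "w \<in> range (frechet_derivative F (at x))" "\<And>z. z \<in> range (frechet_derivative F (at x)) \<Longrightarrow> lorentz w z = 0"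
  shows "w = 0"
proof -
  obtain v where v: "w = frechet_derivative F (at x) v" using assms(2) by auto
  have "v \<bullet> (g x *v v) = lorentz w w"
    unfolding v dF_sum[OF assms(1)]
    by (simp add: g_def inner_vec_def matrix_vector_mult_def lorentz.sum_left lorentz.sum_right lorentz.scaleR_left lorentz.scaleR_right sum_distrib_left mult_ac lorentz_commute)
  moreover have "lorentz w w = 0" using assms(2,3) by blast
  ultimately have "v = 0" using pos[OF assms(1), of v] by (auto simp: g_def)
  then show ?thesis by (simp add: v dF_sum[OF assms(1)])
qed

text \<open>Since \<open>h\<close> inverts the Gram matrix of the coordinate fields,
  \<open>v\<close> and \<open>tangential x v\<close> have equal products with each of them.\<close>

lemma lorentz_proj_range_dF:
  assumes "x \<in> U"
  shows "lorentz_proj (range (frechet_derivative F (at x))) v = tangential x v"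
proof (rule lorentz_proj_eqI)
  have lin: "linear (frechet_derivative F (at x))"
    using F_has_derivative[OF assms] has_derivative_linear by blast
  show sub: "subspace (range (frechet_derivative F (at x)))"
    by (rule linear_subspace_image[OF lin]) auto
  show "tangential x v \<in> range (frechet_derivative F (at x))"
    unfolding tangential_def partial_deriv_def by (intro subspace_sum subspace_scale sub) auto
  have D: "lorentz (tangential x v) (partial_deriv l F x) = lorentz v (partial_deriv l F x)" for l
  proof -
    have "lorentz (tangential x v) (partial_deriv l F x) =
      (\<Sum>i\<in>UNIV. lorentz v (partial_deriv i F x) * (\<Sum>j\<in>UNIV. h x $ i $ j * lorentz (partial_deriv j F x) (partial_deriv l F x)))"
      unfolding tangential_def
      by (simp add: lorentz.sum_left lorentz.scaleR_left sum_distrib_left mult_ac)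
    then show ?thesis by (simp add: h_g[OF assms] if_distrib cong: if_cong)
  qed
  show "lorentz (v - tangential x v) w = 0" if "w \<in> range (frechet_derivative F (at x))" for w
    using that by (auto simp: dF_sum[OF assms] lorentz.sum_right lorentz.scaleR_right lorentz.diff_left D)
qed (use range_dF_nondegenerate[OF assms] in blast)

section \<open>The component along the normal of \<open>Q1\<close>\<close>

lemma snd_F_norm: "y \<in> U \<Longrightarrow> snd (F y) \<bullet> snd (F y) = 1"
  using F_Q1 by (force simp: Q1_def inner_vec_def power2_eq_square)

lemma snd_F_D: 
  assumes "y \<in> U"
  shows "snd (F y) \<bullet> snd (partial_deriv i F y) = 0"
proof -
  have "partial_deriv i (\<lambda>y. snd (F y) \<bullet> snd (F y)) y = 2 * (snd (F y) \<bullet> snd (partial_deriv i F y))"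
    using partial_deriv_eq[OF has_derivative_inner[OF has_derivative_snd[OF F_has_derivative] has_derivative_snd[OF F_has_derivative]], OF assms assms]
    by (simp add: partial_deriv_def inner_commute)
  moreover have "partial_deriv i (\<lambda>y. snd (F y) \<bullet> snd (F y)) y = partial_deriv i (\<lambda>y. 1::real) y"
    using partial_deriv_cong[OF open_U assms snd_F_norm] by simp
  moreover have "partial_deriv i (\<lambda>y. 1::real) y = 0" by (simp add: partial_deriv_def)
  ultimately show ?thesis by simp
qed

text \<open>Obtained by differentiating the orthogonality in \<open>snd_F_D\<close> once
  more.\<close>

lemma snd_F_D2:
  assumes "x \<in> U"
  shows "snd (F x) \<bullet> snd (D2 i j x) = - (snd (partial_deriv i F x) \<bullet> snd (partial_deriv j F x))"
proof -
  have "partial_deriv i (\<lambda>y. snd (F y) \<bullet> snd (partial_deriv j F y)) x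
     = snd (F x) \<bullet> snd (D2 i j x) + snd (partial_deriv i F x) \<bullet> snd (partial_deriv j F x)"
    using partial_deriv_eq[OF has_derivative_inner[OF has_derivative_snd[OF F_has_derivative] has_derivative_snd[OF D_has_derivative]], OF assms assms]
    by (simp add: partial_deriv_def D2_def)
  moreover have "partial_deriv i (\<lambda>y. snd (F y) \<bullet> snd (partial_deriv j F y)) x = partial_deriv i (\<lambda>y. 0::real) x"
    using partial_deriv_cong[OF open_U assms snd_F_D] by simp
  moreover have "partial_deriv i (\<lambda>y. 0::real) x = 0" by (simp add: partial_deriv_def)
  ultimately show ?thesis by simp
qed

text \<open>Contracting \<open>h\<close> with the metric gives the dimension; the double sum, the
  squared norm of the gradient of the time component, comes from the negative term of
  \<open>lorentz\<close>.\<close>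

lemma snd_F_trace_D2:
  assumes "x \<in> U"
  shows "snd (F x) \<bullet> snd (trace_D2 x) =
    - (real CARD('k) + (\<Sum>i\<in>UNIV. \<Sum>j\<in>UNIV. h x $ i $ j * (fst (partial_deriv i F x) * fst (partial_deriv j F x))))"
proof -
  have "(\<Sum>i\<in>UNIV. \<Sum>j\<in>UNIV. h x $ i $ j * lorentz (partial_deriv i F x) (partial_deriv j F x)) = real CARD('k)"
    using h_g[OF assms, of i i for i] by (simp add: lorentz_commute)
  moreover have "h x $ i $ j * lorentz (partial_deriv i F x) (partial_deriv j F x) =
    - (h x $ i $ j * (fst (partial_deriv i F x) * fst (partial_deriv j F x))) - h x $ i $ j * (snd (F x) \<bullet> snd (D2 i j x))" for i j
    by (simp add: snd_F_D2[OF assms] lorentz_def algebra_simps)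
  ultimately show ?thesis
    by (simp add: trace_D2_def snd_sum inner_sum_right sum_subtractf sum_negf)
qed

text \<open>The normal of \<open>Q1\<close> is orthogonal to the image of the differential, so \<nu>
  and the second partial derivatives have the same tangential part. Linearity then moves the trace
  inside the projections.\<close>

lemma trace_second_fundamental_form:
  assumes "x \<in> U"
  defines "\<nu> \<equiv> \<lambda>i j. lorentz_proj (tangent_Q1 (F x)) (D2 i j x)"
  shows "(\<Sum>i\<in>UNIV. \<Sum>j\<in>UNIV. (h x $ i $ j) *\<^sub>R (\<nu> i j - lorentz_proj (range (frechet_derivative F (at x))) (\<nu> i j)))
    = trace_D2 x - tangential x (trace_D2 x) - (snd (F x) \<bullet> snd (trace_D2 x)) *\<^sub>R (0, snd (F x))"
proof -
  interpret P: linear "tangential x"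
    by (rule linearI)
       (simp_all add: tangential_def lorentz.add_left lorentz.scaleR_left sum.distrib distrib_left scaleR_add_left scaleR_sum_right mult_ac)
  define N where "N = (0::real, snd (F x))"
  have \<nu>: "\<nu> i j = D2 i j x - (snd (F x) \<bullet> snd (D2 i j x)) *\<^sub>R N" for i j
    unfolding \<nu>_def N_def using F_Q1 assms by (intro lorentz_proj_tangent_Q1) auto
  have "tangential x N = 0"
    by (simp add: N_def tangential_def lorentz_def snd_F_D[OF assms(1)])
  then have "tangential x (\<nu> i j) = tangential x (D2 i j x)" for i j
    by (simp add: \<nu> P.diff P.scale)
  then show ?thesis
    unfolding N_def[symmetric] lorentz_proj_range_dF[OF assms(1)]
    by (simp add: trace_D2_def P.sum P.scale \<nu> snd_sum inner_sum_right
        scaleR_diff_right sum_subtractf scaleR_sum_left)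
qed

end

text \<open>All quantities at \<open>p\<close> are evaluated in the same chart
  \<open>chart_at A p\<close>, so the identity reduces to the locale for that chart. It is pointwise
  and yields both directions of the equivalence.\<close>

lemma mean_curvature_eq_laplacian:
  fixes A :: "('m, 'k::finite) chart set" and \<Psi> :: "'m \<Rightarrow> 'd::finite minkowski"
  assumes M: "smooth_manifold M A" and Q1: "\<Psi> \<in> topspace M \<rightarrow> Q1" and \<Psi>: "spacelike_immersion M A \<Psi>"
    and p: "p \<in> topspace M"
  shows "real CARD('k) *\<^sub>R mean_curvature A \<Psi> p =
    (laplacian A (induced_metric \<Psi>) (\<lambda>q. fst (\<Psi> q)) p,
     \<chi> i. laplacian A (induced_metric \<Psi>) (\<lambda>q. snd (\<Psi> q) $ i) p
       + (real CARD('k) + (metric_norm A (induced_metric \<Psi>)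
            (gradient (induced_metric \<Psi>) (\<lambda>q. fst (\<Psi> q))) p)\<^sup>2) * snd (\<Psi> p) $ i)"
proof -
  define c where "c = chart_at A p"
  have "\<exists>c. c \<in> A \<and> p \<in> fst c"
    using M p unfolding smooth_manifold_def by blast
  then have c: "c \<in> A" "p \<in> fst c"
    unfolding c_def chart_at_def by (metis (mono_tags, lifting) someI_ex)+
  have chart: "is_chart M c" using M c by (simp add: smooth_manifold_def)
  then have dom: "fst c \<subseteq> topspace M" by (simp add: is_chart_def openin_subset)
  have inj: "inj_on (snd c) (fst c)"
    using chart dom unfolding is_chart_def
    by (metis homeomorphic_imp_injective_map topspace_subtopology_subset)
  define U where "U = snd c ` fst c"
  define F where "F = coord_rep c \<Psi>"
  define x where "x = snd c p"
  have x: "x \<in> U" using c by (simp add: U_def x_def)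
  have Fx: "F x = \<Psi> p"
    using c inj by (simp add: F_def x_def coord_rep_def)
  have metric: "induced_metric \<Psi> c y = (\<chi> i j. lorentz (partial_deriv i F y) (partial_deriv j F y))" for y
    by (simp add: induced_metric_def differential_def F_def partial_deriv_def)
  interpret P: spacelike_parametrization F U
  proof
    show "open U" using chart by (simp add: is_chart_def U_def)
    show "Ck_on 2 U F"
      using \<Psi> c by (simp add: spacelike_immersion_def smooth_map_def smooth_on_def F_def U_def)
    show "F ` U \<subseteq> Q1"
      using Q1 dom by (auto simp: F_def U_def coord_rep_def inj)
    fix y :: "real^'k" and v :: "real^'k" assume "y \<in> U" "v \<noteq> 0"
    then have "v \<bullet> (induced_metric \<Psi> c y *v v) > 0"
      using \<Psi> c(1) by (auto simp: spacelike_immersion_def U_def)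
    then show "v \<bullet> ((\<chi> i j. lorentz (partial_deriv i F y) (partial_deriv j F y)) *v v) > 0"
      by (simp only: metric)
  qed
  have ind: "induced_metric \<Psi> c = P.g"
    by (rule ext) (simp add: metric P.g_def)
  \<comment> \<open>Stated on all of \<open>U\<close> and not only at \<open>x\<close>, because the
    divergence differentiates the gradient.\<close>
  have grad: "gradient (induced_metric \<Psi>) (\<lambda>q. L (\<Psi> q)) c y = P.h y *v (\<chi> j. L (partial_deriv j F y))"
    if "bounded_linear L" "y \<in> U" for L y
  proof -
    have "coord_rep c (\<lambda>q. L (\<Psi> q)) = (\<lambda>y. L (F y))" by (simp add: coord_rep_def F_def fun_eq_iff)
    moreover have "partial_deriv j (\<lambda>y. L (F y)) y = L (partial_deriv j F y)" for j
      using partial_deriv_eq[OF bounded_linear.has_derivative[OF that(1) P.F_has_derivative[OF that(2)]]]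
      by (simp add: partial_deriv_def)
    ultimately show ?thesis by (simp add: gradient_def ind)
  qed
  have lap: "laplacian A (induced_metric \<Psi>) (\<lambda>q. L (\<Psi> q)) p = L (P.trace_D2 x - P.tangential x (P.trace_D2 x))"
    if L: "bounded_linear L" for L
  proof -
    have "partial_deriv i (\<lambda>y. gradient (induced_metric \<Psi>) (\<lambda>q. L (\<Psi> q)) c y $ i) x
       = partial_deriv i (\<lambda>y. (P.h y *v (\<chi> j. L (partial_deriv j F y))) $ i) x" for i
      by (rule partial_deriv_cong[OF P.open_U x]) (simp add: grad[OF L])
    then show ?thesis
      unfolding P.laplacian_linear[OF L x, symmetric]
      by (simp add: laplacian_def divergence_def Let_def c_def[symmetric] x_def[symmetric] ind grad[OF L x])
  qed
  have norm: "(metric_norm A (induced_metric \<Psi>) (gradient (induced_metric \<Psi>) (\<lambda>q. fst (\<Psi> q))) p)\<^sup>2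
    = (\<Sum>i\<in>UNIV. \<Sum>j\<in>UNIV. P.h x $ i $ j * (fst (partial_deriv i F x) * fst (partial_deriv j F x)))"
  proof -
    define b where "b = (\<chi> j. fst (partial_deriv j F x))"
    define X where "X = P.h x *v b"
    \<comment> \<open>Nonnegativity lets the square cancel the root in \<open>metric_norm\<close>;
      \<open>P.pos\<close> covers only nonzero vectors.\<close>
    have "X \<bullet> (P.g x *v X) \<ge> 0"
      using P.pos[OF x, of X] by (cases "X = 0") (auto simp: P.g_def)
    then have "(metric_norm A (induced_metric \<Psi>) (gradient (induced_metric \<Psi>) (\<lambda>q. fst (\<Psi> q))) p)\<^sup>2 = X \<bullet> (P.g x *v X)"
      by (simp add: metric_norm_def Let_def c_def[symmetric] x_def[symmetric] ind grad[OF bounded_linear_fst x] X_def b_def)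
    also have "P.g x *v X = b"
      unfolding X_def using P.g_invertible[OF x] by (simp add: matrix_vector_mul_assoc matrix_inv_right)
    also have "X \<bullet> b = (\<Sum>i\<in>UNIV. \<Sum>j\<in>UNIV. P.h x $ i $ j * (b $ i * b $ j))"
      by (simp add: X_def inner_vec_def matrix_vector_mult_def sum_distrib_left sum_distrib_right mult_ac)
    finally show ?thesis by (simp add: b_def)
  qed
  have "real CARD('k) *\<^sub>R mean_curvature A \<Psi> p
    = P.trace_D2 x - P.tangential x (P.trace_D2 x) - (snd (F x) \<bullet> snd (P.trace_D2 x)) *\<^sub>R (0, snd (F x))"
    unfolding P.trace_second_fundamental_form[OF x, symmetric]
    by (simp add: mean_curvature_def Let_def c_def[symmetric] x_def[symmetric] ind second_fundamental_form_def
        connection_Q1_def differential_def F_def[symmetric] P.D2_def partial_deriv_def[abs_def])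
  also have "\<dots> = P.trace_D2 x - P.tangential x (P.trace_D2 x) + (real CARD('k)
      + (\<Sum>i\<in>UNIV. \<Sum>j\<in>UNIV. P.h x $ i $ j * (fst (partial_deriv i F x) * fst (partial_deriv j F x)))) *\<^sub>R (0, snd (\<Psi> p))"
    by (simp only: P.snd_F_trace_D2[OF x, unfolded Fx] Fx scaleR_minus_left diff_minus_eq_add)
  finally have mc: "real CARD('k) *\<^sub>R mean_curvature A \<Psi> p = \<dots>" .
  have "bounded_linear (\<lambda>v :: 'd minkowski. snd v $ i)" for i
    using bounded_linear_compose[OF bounded_linear_vec_nth bounded_linear_snd] .
  note lap_snd = lap[OF this]
  show ?thesis
    unfolding norm lap[OF bounded_linear_fst] lap_snd mc by (simp add: prod_eq_iff vec_eq_iff)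
qed

theorem corollary4p3:
  fixes M :: "'m topology"
    and A :: "('m, 'k::finite) chart set"
    and \<Psi> :: "'m \<Rightarrow> real \<times> (real^'d::finite)"
    and n :: nat
  assumes "CARD('d) = n + 1"
    and "smooth_manifold M A"
    and "\<Psi> \<in> topspace M \<rightarrow> Q1"
    and "spacelike_immersion M A \<Psi>"
  shows "stationary_in_Q1 M A \<Psi> \<longleftrightarrow>
    (\<forall>p\<in>topspace M. laplacian A (induced_metric \<Psi>) (\<lambda>q. fst (\<Psi> q)) p = 0) \<and>
    (\<forall>i. \<forall>p\<in>topspace M.
       laplacian A (induced_metric \<Psi>) (\<lambda>q. snd (\<Psi> q) $ i) p
       + (real CARD('k)
          + (metric_norm A (induced_metric \<Psi>)
               (gradient (induced_metric \<Psi>) (\<lambda>q. fst (\<Psi> q))) p)^2) * snd (\<Psi> p) $ i = 0)"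
proof -
  have "mean_curvature A \<Psi> p = 0 \<longleftrightarrow>
    laplacian A (induced_metric \<Psi>) (\<lambda>q. fst (\<Psi> q)) p = 0 \<and>
    (\<forall>i. laplacian A (induced_metric \<Psi>) (\<lambda>q. snd (\<Psi> q) $ i) p
       + (real CARD('k)
          + (metric_norm A (induced_metric \<Psi>)
               (gradient (induced_metric \<Psi>) (\<lambda>q. fst (\<Psi> q))) p)^2) * snd (\<Psi> p) $ i = 0)"
    if "p \<in> topspace M" for p
  proof -
    \<comment> \<open>The factor is positive because \<open>'k\<close> is a finite type.\<close>
    have "mean_curvature A \<Psi> p = 0 \<longleftrightarrow> real CARD('k) *\<^sub>R mean_curvature A \<Psi> p = 0" by simp
    then show ?thesis
      unfolding mean_curvature_eq_laplacian[OF assms(2-4) that] by (simp add: prod_eq_iff vec_eq_iff)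
  qed
  then show ?thesis
    unfolding stationary_in_Q1_def by blast
qed

end
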